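(* Let $k$ be an uncountable algebraically closed field of characteristic zero. Let $X = \varinjlim X_n$ be an affine ind-variety over $k$ such that the number of irreducible components of $X_n$ is bounded for all $n$ (by a constant independent of $n$). Then $X$ is irreducible with respect to the ind-topology if and only if there exists a chain of irreducible subvarieties $X'_1 \subseteq X'_2 \subseteq \cdots$ in $X$ (i.e. each $X'_n$ is an irreducible subvariety of some $X_m$) such that $\bigcup_n X'_n$ is dense in $X$ with respect to the ind-topology. The same equivalence holds with "ind-topology" replaced by "Zariski topology" in both places.
   Context: Affine varieties over $k$ are reduced, of finite type, and not necessarily irreducible. An affine ind-variety $X = \varinjlim X_n$ is given by a filtration, i.e. a countable sequence of closed embeddings of affine varieties $X_1 \hookrightarrow X_2 \hookrightarrow X_3 \hookrightarrow \cdots$. As a set, $X = \bigcup_{n} X_n$, and its ring of regular functions is $\mathcal{O}(X) = \varprojlim \mathcal{O}(X_n)$ (transition maps are restrictions), with the topology induced from the product topology of $\prod_n \mathcal{O}(X_n)$, each $\mathcal{O}(X_n)$ being discrete. Two topologies on $X$: in the ind-topology, a subset $Y \subseteq X$ is closed iff $Y \cap X_n$ is Zariski closed in the variety $X_n$ for every $n$. In the Zariski topology, the closed subsets of $X$ are the common zero sets in $X$ of subsets $E \subseteq \mathcal{O}(X)$. *)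

theory Defs
  imports "HOL-Analysis.Analysis" "HOL-Computational_Algebra.Polynomial"
begin

section \<open>Irreducibility\<close>

text \<open>The empty space is not irreducible.\<close>

definition irreducible_space :: "'a topology \<Rightarrow> bool" where
  "irreducible_space T \<longleftrightarrow> topspace T \<noteq> {} \<and>
     (\<forall>C D. closedin T C \<and> closedin T D \<and> C \<union> D = topspace T \<longrightarrow> C = topspace T \<or> D = topspace T)"

definition irreduciblein :: "'a topology \<Rightarrow> 'a set \<Rightarrow> bool" where
  "irreduciblein T S \<longleftrightarrow> S \<subseteq> topspace T \<and> irreducible_space (subtopology T S)"

definition irreducible_components :: "'a topology \<Rightarrow> 'a set set" where
  "irreducible_components T =
     {C. irreduciblein T C \<and> (\<forall>S. irreduciblein T S \<and> C \<subseteq> S \<longrightarrow> S = C)}"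


section \<open>Topologies given by their closed sets\<close>

definition topology_of_closed :: "'a set \<Rightarrow> ('a set \<Rightarrow> bool) \<Rightarrow> 'a topology" where
  "topology_of_closed X P = topology (\<lambda>U. U \<subseteq> X \<and> P (X - U))"

lemma
  assumes sub: "\<And>C. P C \<Longrightarrow> C \<subseteq> X"
    and top: "P X" and bot: "P {}"
    and un: "\<And>C D. P C \<Longrightarrow> P D \<Longrightarrow> P (C \<union> D)"
    and int: "\<And>K. K \<noteq> {} \<Longrightarrow> (\<And>C. C \<in> K \<Longrightarrow> P C) \<Longrightarrow> P (\<Inter>K)"
  shows topspace_topology_of_closed: "topspace (topology_of_closed X P) = X"
    and closedin_topology_of_closed: "closedin (topology_of_closed X P) C \<longleftrightarrow> P C"
proof -
  have "istopology (\<lambda>U. U \<subseteq> X \<and> P (X - U))"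
    unfolding istopology_def
  proof (intro conjI allI impI)
    fix S T assume "S \<subseteq> X \<and> P (X - S)" "T \<subseteq> X \<and> P (X - T)"
    then show "S \<inter> T \<subseteq> X" "P (X - S \<inter> T)"
      using un[of "X - S" "X - T"] by (auto simp: Diff_Int)
  next
    fix \<K> assume K: "\<forall>U\<in>\<K>. U \<subseteq> X \<and> P (X - U)"
    then show "\<Union>\<K> \<subseteq> X" by blast
    show "P (X - \<Union>\<K>)"
    proof (cases "\<K> = {}")
      case True
      then show ?thesis using top by simp
    next
      case False
      then have "X - \<Union>\<K> = \<Inter>((\<lambda>U. X - U) ` \<K>)" by blast
      moreover have "P (\<Inter>((\<lambda>U. X - U) ` \<K>))"
        using False K by (intro int) auto
      ultimately show ?thesis by simp
    qed
  qed
  then have op: "openin (topology_of_closed X P) U \<longleftrightarrow> U \<subseteq> X \<and> P (X - U)" for U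
    by (simp add: topology_of_closed_def)
  show ts: "topspace (topology_of_closed X P) = X"
  proof
    show "topspace (topology_of_closed X P) \<subseteq> X"
      using op openin_topspace by blast
    show "X \<subseteq> topspace (topology_of_closed X P)"
      using op[of X] bot by (intro openin_subset) simp
  qed
  show "closedin (topology_of_closed X P) C \<longleftrightarrow> P C"
    unfolding closedin_def ts op using sub by (auto simp: double_diff)
qed


section \<open>Affine varieties\<close>

text \<open>
  Points of affine \<open>d\<close>-space are the functions on \<open>{..<d}\<close>, extended by \<^const>\<open>undefined\<close>.
  As the base field will be infinite, polynomials in \<open>d\<close> variables may be identified with the
  functions they define.
\<close>

definition affine_space :: "nat \<Rightarrow> (nat \<Rightarrow> 'k) set" where
  "affine_space d = ({..<d} \<rightarrow>\<^sub>E UNIV)"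

inductive_set polynomial_functions :: "nat \<Rightarrow> ((nat \<Rightarrow> 'k::field) \<Rightarrow> 'k) set" for d where
  const: "(\<lambda>x. c) \<in> polynomial_functions d"
| coord: "i < d \<Longrightarrow> (\<lambda>x. x i) \<in> polynomial_functions d"
| add: "\<lbrakk>p \<in> polynomial_functions d; q \<in> polynomial_functions d\<rbrakk>
        \<Longrightarrow> (\<lambda>x. p x + q x) \<in> polynomial_functions d"
| mult: "\<lbrakk>p \<in> polynomial_functions d; q \<in> polynomial_functions d\<rbrakk>
        \<Longrightarrow> (\<lambda>x. p x * q x) \<in> polynomial_functions d"

definition algebraic_set :: "nat \<Rightarrow> (nat \<Rightarrow> 'k::field) set \<Rightarrow> bool" where
  "algebraic_set d Z \<longleftrightarrow>
     (\<exists>E \<subseteq> polynomial_functions d. Z = {x \<in> affine_space d. \<forall>p\<in>E. p x = 0})"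

text \<open>
  A variety is a set of points with its ring of regular functions, the latter normalised to
  \<^const>\<open>undefined\<close> outside the set of points. It is affine if it is isomorphic to a
  Zariski closed subset of some affine space with the restrictions of polynomials.
\<close>

record ('a, 'k) variety =
  points :: "'a set"
  regular :: "('a \<Rightarrow> 'k) set"

definition affine_variety :: "('a, 'k::field) variety \<Rightarrow> bool" where
  "affine_variety V \<longleftrightarrow>
     (\<exists>d \<phi>. inj_on \<phi> (points V) \<and> algebraic_set d (\<phi> ` points V) \<and>
        regular V = (\<lambda>p. restrict (p \<circ> \<phi>) (points V)) ` polynomial_functions d)"

definition zero_set :: "('a, 'k::field) variety \<Rightarrow> ('a \<Rightarrow> 'k) set \<Rightarrow> 'a set" where
  "zero_set V E = {x \<in> points V. \<forall>f\<in>E. f x = 0}"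

definition zariski_topology :: "('a, 'k::field) variety \<Rightarrow> 'a topology" where
  "zariski_topology V = topology_of_closed (points V) (\<lambda>C. \<exists>E \<subseteq> regular V. C = zero_set V E)"

definition morphism :: "('a, 'k) variety \<Rightarrow> ('b, 'k) variety \<Rightarrow> ('a \<Rightarrow> 'b) \<Rightarrow> bool" where
  "morphism V W f \<longleftrightarrow> f \<in> points V \<rightarrow> points W \<and>
     (\<forall>g \<in> regular W. restrict (g \<circ> f) (points V) \<in> regular V)"

definition isomorphism :: "('a, 'k) variety \<Rightarrow> ('b, 'k) variety \<Rightarrow> ('a \<Rightarrow> 'b) \<Rightarrow> bool" where
  "isomorphism V W f \<longleftrightarrow> bij_betw f (points V) (points W) \<and>
     morphism V W f \<and> morphism W V (inv_into (points V) f)"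

definition subvariety :: "('a, 'k) variety \<Rightarrow> 'a set \<Rightarrow> ('a, 'k) variety" where
  "subvariety W Z = \<lparr>points = Z, regular = (\<lambda>g. restrict g Z) ` regular W\<rparr>"

definition closed_embedding ::
  "('a, 'k::field) variety \<Rightarrow> ('b, 'k) variety \<Rightarrow> ('a \<Rightarrow> 'b) \<Rightarrow> bool" where
  "closed_embedding V W f \<longleftrightarrow> closedin (zariski_topology W) (f ` points V) \<and>
     isomorphism V (subvariety W (f ` points V)) f"

lemma affine_variety_regular:
  assumes "affine_variety V"
  shows regular_const: "restrict (\<lambda>x. c) (points V) \<in> regular V"
    and regular_mult: "f \<in> regular V \<Longrightarrow> g \<in> regular V \<Longrightarrow>
          restrict (\<lambda>x. f x * g x) (points V) \<in> regular V"
proof -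
  obtain d \<phi> where reg:
    "regular V = (\<lambda>p. restrict (p \<circ> \<phi>) (points V)) ` polynomial_functions d"
    using assms by (auto simp: affine_variety_def)
  show "restrict (\<lambda>x. c) (points V) \<in> regular V"
    unfolding reg
    by (rule image_eqI[OF _ polynomial_functions.const[of c]]) (auto simp: o_def)
  assume "f \<in> regular V" "g \<in> regular V"
  then obtain p q where pq: "p \<in> polynomial_functions d" "q \<in> polynomial_functions d"
    "f = restrict (p \<circ> \<phi>) (points V)" "g = restrict (q \<circ> \<phi>) (points V)"
    unfolding reg by blast
  then show "restrict (\<lambda>x. f x * g x) (points V) \<in> regular V"
    unfolding reg
    by (intro image_eqI[OF _ polynomial_functions.mult[OF pq(1,2)]]) (auto simp: restrict_def)
qed

lemma zariski_topology_affine: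
  assumes "affine_variety V"
  shows topspace_zariski: "topspace (zariski_topology V) = points V"
    and closedin_zariski:
      "closedin (zariski_topology V) C \<longleftrightarrow> (\<exists>E \<subseteq> regular V. C = zero_set V E)"
proof -
  let ?P = "\<lambda>C. \<exists>E \<subseteq> regular V. C = zero_set V E"
  have 1: "C \<subseteq> points V" if "?P C" for C
    using that by (auto simp: zero_set_def)
  have 2: "?P (points V)"
    by (rule exI[of _ "{}"]) (simp add: zero_set_def)
  have 3: "?P {}"
    using regular_const[OF assms, of 1]
    by (intro exI[of _ "{restrict (\<lambda>x. 1) (points V)}"]) (auto simp: zero_set_def)
  have 4: "?P (C \<union> D)" if "?P C" "?P D" for C D
  proof -
    from that obtain E F where EF: "E \<subseteq> regular V" "C = zero_set V E"
      "F \<subseteq> regular V" "D = zero_set V F" by blast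
    let ?G = "(\<lambda>(f, g). restrict (\<lambda>x. f x * g x) (points V)) ` (E \<times> F)"
    have "?G \<subseteq> regular V"
      using EF by (auto intro!: regular_mult[OF assms])
    moreover have "C \<union> D = zero_set V ?G"
      unfolding EF(2,4) zero_set_def by (auto; blast)
    ultimately show ?thesis by blast
  qed
  have 5: "?P (\<Inter>K)" if "K \<noteq> {}" "\<And>C. C \<in> K \<Longrightarrow> ?P C" for K
  proof -
    from that(2) obtain E where E: "\<And>C. C \<in> K \<Longrightarrow> E C \<subseteq> regular V \<and> C = zero_set V (E C)"
      by metis
    have "\<Inter>K = (\<Inter>C\<in>K. zero_set V (E C))" using E by auto
    also have "\<dots> = zero_set V (\<Union>C\<in>K. E C)"
      using that(1) by (auto simp: zero_set_def)
    finally show ?thesis using E by (intro exI[of _ "\<Union>C\<in>K. E C"]) auto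
  qed
  show "topspace (zariski_topology V) = points V"
    unfolding zariski_topology_def
    by (rule topspace_topology_of_closed[where P="?P", OF 1 2 3 4 5])
  show "closedin (zariski_topology V) C \<longleftrightarrow> ?P C"
    unfolding zariski_topology_def
    by (rule closedin_topology_of_closed[where P="?P", OF 1 2 3 4 5])
qed


section \<open>Affine ind-varieties\<close>

text \<open>
  As usual, each member of the filtration is identified with its image in the limit, so that the
  closed embeddings are inclusions and the limit is the union.
\<close>

definition affine_ind_variety :: "(nat \<Rightarrow> ('a, 'k::field) variety) \<Rightarrow> bool" where
  "affine_ind_variety V \<longleftrightarrow>
     (\<forall>n. affine_variety (V n)) \<and> (\<forall>n. closed_embedding (V n) (V (Suc n)) (\<lambda>x. x))"

definition ind_points :: "(nat \<Rightarrow> ('a, 'k) variety) \<Rightarrow> 'a set" where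
  "ind_points V = (\<Union>n. points (V n))"

text \<open>The inverse limit of the rings of regular functions, and the values of its elements.\<close>

definition ind_regular :: "(nat \<Rightarrow> ('a, 'k) variety) \<Rightarrow> (nat \<Rightarrow> 'a \<Rightarrow> 'k) set" where
  "ind_regular V =
     {f. (\<forall>n. f n \<in> regular (V n)) \<and> (\<forall>n. restrict (f (Suc n)) (points (V n)) = f n)}"

definition ind_eval :: "(nat \<Rightarrow> ('a, 'k) variety) \<Rightarrow> (nat \<Rightarrow> 'a \<Rightarrow> 'k) \<Rightarrow> 'a \<Rightarrow> 'k" where
  "ind_eval V f x = f (LEAST n. x \<in> points (V n)) x"

definition ind_zero_set ::
  "(nat \<Rightarrow> ('a, 'k::field) variety) \<Rightarrow> (nat \<Rightarrow> 'a \<Rightarrow> 'k) set \<Rightarrow> 'a set" where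
  "ind_zero_set V E = {x \<in> ind_points V. \<forall>f\<in>E. ind_eval V f x = 0}"

definition ind_topology :: "(nat \<Rightarrow> ('a, 'k::field) variety) \<Rightarrow> 'a topology" where
  "ind_topology V = topology_of_closed (ind_points V)
     (\<lambda>Y. Y \<subseteq> ind_points V \<and> (\<forall>n. closedin (zariski_topology (V n)) (Y \<inter> points (V n))))"

definition ind_zariski_topology :: "(nat \<Rightarrow> ('a, 'k::field) variety) \<Rightarrow> 'a topology" where
  "ind_zariski_topology V =
     topology_of_closed (ind_points V) (\<lambda>Y. \<exists>E \<subseteq> ind_regular V. Y = ind_zero_set V E)"

definition irreducible_subvariety :: "(nat \<Rightarrow> ('a, 'k::field) variety) \<Rightarrow> 'a set \<Rightarrow> bool" where
  "irreducible_subvariety V Z \<longleftrightarrow>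
     (\<exists>m. closedin (zariski_topology (V m)) Z \<and> irreduciblein (zariski_topology (V m)) Z)"

lemma points_Suc_subset:
  assumes "affine_ind_variety V"
  shows "points (V n) \<subseteq> points (V (Suc n))"
proof -
  have "closedin (zariski_topology (V (Suc n))) (points (V n))"
    "affine_variety (V (Suc n))"
    using assms by (auto simp: affine_ind_variety_def closed_embedding_def)
  then show ?thesis
    using closedin_subset topspace_zariski by metis
qed

lemma ind_eval_eq:
  assumes V: "affine_ind_variety V" and f: "f \<in> ind_regular V" and x: "x \<in> points (V n)"
  shows "ind_eval V f x = f n x"
proof -
  let ?m = "LEAST n. x \<in> points (V n)"
  have m: "x \<in> points (V ?m)" and "?m \<le> n"
    using x by (auto intro: LeastI Least_le)
  have "x \<in> points (V (?m + j)) \<and> f (?m + j) x = f ?m x" for j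
  proof (induction j)
    case (Suc j)
    then have "f (Suc (?m + j)) x = f (?m + j) x"
      using f unfolding ind_regular_def by (metis (mono_tags, lifting) mem_Collect_eq restrict_apply')
    then show ?case
      using Suc points_Suc_subset[OF V] by auto
  qed (simp add: m)
  from this[of "n - ?m"] show ?thesis
    using \<open>?m \<le> n\<close> by (simp add: ind_eval_def)
qed

lemma ind_topology_affine:
  assumes "affine_ind_variety V"
  shows topspace_ind_topology: "topspace (ind_topology V) = ind_points V"
    and closedin_ind_topology: "closedin (ind_topology V) Y \<longleftrightarrow>
      Y \<subseteq> ind_points V \<and> (\<forall>n. closedin (zariski_topology (V n)) (Y \<inter> points (V n)))"
proof -
  let ?P = "\<lambda>Y. Y \<subseteq> ind_points V \<and> (\<forall>n. closedin (zariski_topology (V n)) (Y \<inter> points (V n)))"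
  have "affine_variety (V n)" for n
    using assms by (simp add: affine_ind_variety_def)
  then have ts: "closedin (zariski_topology (V n)) (points (V n))" for n
    by (metis closedin_topspace topspace_zariski)
  have eq: "ind_points V \<inter> points (V n) = points (V n)" for n
    by (auto simp: ind_points_def)
  have 2: "?P (ind_points V)" using ts by (simp add: eq)
  have 4: "?P (C \<union> D)" if "?P C" "?P D" for C D
    using that by (auto simp: Int_Un_distrib2)
  have 5: "?P (\<Inter>K)" if "K \<noteq> {}" "\<And>C. C \<in> K \<Longrightarrow> ?P C" for K
  proof -
    have "\<Inter>K \<inter> points (V n) = \<Inter>((\<lambda>C. C \<inter> points (V n)) ` K)" for n
      using that(1) by auto
    moreover have "closedin (zariski_topology (V n)) (\<Inter>((\<lambda>C. C \<inter> points (V n)) ` K))" for n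
      using that by (intro closedin_Inter) auto
    moreover have "\<Inter>K \<subseteq> ind_points V"
      using that by blast
    ultimately show ?thesis by simp
  qed
  show "topspace (ind_topology V) = ind_points V"
    unfolding ind_topology_def
    by (rule topspace_topology_of_closed[OF _ 2 _ 4 5]) auto
  show "closedin (ind_topology V) Y \<longleftrightarrow> ?P Y"
    unfolding ind_topology_def
    by (rule closedin_topology_of_closed[OF _ 2 _ 4 5]) auto
qed

lemma ind_regular_const:
  assumes "affine_ind_variety V"
  shows "(\<lambda>n. restrict (\<lambda>x. c) (points (V n))) \<in> ind_regular V"
  using assms points_Suc_subset[OF assms]
  by (auto simp: ind_regular_def affine_ind_variety_def fun_eq_iff restrict_def
      intro: regular_const[unfolded restrict_def])

lemma ind_regular_mult:
  assumes "affine_ind_variety V" "f \<in> ind_regular V" "g \<in> ind_regular V"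
  shows "(\<lambda>n. restrict (\<lambda>x. f n x * g n x) (points (V n))) \<in> ind_regular V"
proof -
  have "f (Suc n) x = f n x \<and> g (Suc n) x = g n x" if "x \<in> points (V n)" for n x
    using assms(2,3) that unfolding ind_regular_def
    by (metis (mono_tags, lifting) mem_Collect_eq restrict_apply')
  then show ?thesis
    using assms points_Suc_subset[OF assms(1)]
    by (auto simp: ind_regular_def affine_ind_variety_def fun_eq_iff restrict_def
        intro: regular_mult[unfolded restrict_def])
qed

lemma ind_zariski_topology_affine:
  assumes V: "affine_ind_variety V"
  shows topspace_ind_zariski: "topspace (ind_zariski_topology V) = ind_points V"
    and closedin_ind_zariski: "closedin (ind_zariski_topology V) Y \<longleftrightarrow>
      (\<exists>E \<subseteq> ind_regular V. Y = ind_zero_set V E)"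
proof -
  let ?P = "\<lambda>Y. \<exists>E \<subseteq> ind_regular V. Y = ind_zero_set V E"
  have 1: "C \<subseteq> ind_points V" if "?P C" for C
    using that by (auto simp: ind_zero_set_def)
  have 2: "?P (ind_points V)"
    by (rule exI[of _ "{}"]) (simp add: ind_zero_set_def)
  have 3: "?P {}"
  proof -
    let ?c = "\<lambda>n. restrict (\<lambda>x. 1) (points (V n))"
    have "ind_eval V ?c x = 1" if "x \<in> ind_points V" for x
      using that ind_eval_eq[OF V ind_regular_const[OF V]] by (auto simp: ind_points_def)
    then have "{} = ind_zero_set V {?c}" by (auto simp: ind_zero_set_def)
    then show ?thesis using ind_regular_const[OF V, of 1] by blast
  qed
  have 4: "?P (C \<union> D)" if "?P C" "?P D" for C D
  proof -
    from that obtain E F where EF: "E \<subseteq> ind_regular V" "C = ind_zero_set V E"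
      "F \<subseteq> ind_regular V" "D = ind_zero_set V F" by blast
    define m where "m f g = (\<lambda>n. restrict (\<lambda>x. f n x * g n x) (points (V n)))"
      for f g :: "nat \<Rightarrow> 'a \<Rightarrow> 'b"
    have m: "m f g \<in> ind_regular V" if "f \<in> E" "g \<in> F" for f g
      unfolding m_def using that EF by (intro ind_regular_mult[OF V]) auto
    have ev: "ind_eval V (m f g) x = ind_eval V f x * ind_eval V g x"
      if fg: "f \<in> E" "g \<in> F" and x: "x \<in> ind_points V" for f g x
    proof -
      obtain n where n: "x \<in> points (V n)" using x by (auto simp: ind_points_def)
      have "f \<in> ind_regular V" "g \<in> ind_regular V" using fg EF by auto
      then show ?thesis
        using ind_eval_eq[OF V _ n] m[OF fg] n by (simp add: m_def)
    qed
    let ?G = "(\<lambda>(f, g). m f g) ` (E \<times> F)"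
    have "?G \<subseteq> ind_regular V" using m by auto
    moreover have "C \<union> D = ind_zero_set V ?G"
      unfolding EF(2,4) ind_zero_set_def by (auto simp: ev)
    ultimately show ?thesis by blast
  qed
  have 5: "?P (\<Inter>K)" if "K \<noteq> {}" "\<And>C. C \<in> K \<Longrightarrow> ?P C" for K
  proof -
    from that(2) obtain E
      where E: "\<And>C. C \<in> K \<Longrightarrow> E C \<subseteq> ind_regular V \<and> C = ind_zero_set V (E C)"
      by metis
    have "\<Inter>K = (\<Inter>C\<in>K. ind_zero_set V (E C))" using E by auto
    also have "\<dots> = ind_zero_set V (\<Union>C\<in>K. E C)"
      using that(1) by (auto simp: ind_zero_set_def)
    finally show ?thesis using E by (intro exI[of _ "\<Union>C\<in>K. E C"]) auto
  qed
  show "topspace (ind_zariski_topology V) = ind_points V"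
    unfolding ind_zariski_topology_def
    by (rule topspace_topology_of_closed[where P="?P", OF 1 2 3 4 5])
  show "closedin (ind_zariski_topology V) Y \<longleftrightarrow> ?P Y"
    unfolding ind_zariski_topology_def
    by (rule closedin_topology_of_closed[where P="?P", OF 1 2 3 4 5])
qed

end

theory Submission
  imports Defs
begin

text \<open>
  The easy direction is pure topology: the union of a chain of irreducible sets is irreducible,
  and so is the closure of an irreducible set.

  For the other direction, send each irreducible component of \<open>X\<^sub>n\<close> to some component of
  \<open>X\<^sub>n\<^sub>+\<^sub>1\<close> that contains it. Following these maps from a given component yields a chain of
  irreducible subvarieties, and any two chains that meet at some level have the same union. Hence
  different unions give different components at all high levels, and the bound on the number of
  components bounds the number of unions (\<open>finitely_many_chains\<close>). As each point lies on a component
  of some \<open>X\<^sub>n\<close>, these finitely many unions cover \<open>X\<close>. If \<open>X\<close> is irreducible, then one of their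
  closures must be all of \<open>X\<close>.

  One argument serves both topologies on \<open>X\<close>, because both make the inclusions of the \<open>X\<^sub>n\<close>
  continuous (\<open>irreducible_iff_dense_chain\<close>).
\<close>

section \<open>Irreducible sets in topological spaces\<close>

lemma irreduciblein_iff:
  "irreduciblein T S \<longleftrightarrow> S \<subseteq> topspace T \<and> S \<noteq> {} \<and>
     (\<forall>C D. closedin T C \<and> closedin T D \<and> S \<subseteq> C \<union> D \<longrightarrow> S \<subseteq> C \<or> S \<subseteq> D)"
proof (cases "S \<subseteq> topspace T")
  case True
  have "(\<forall>C D. closedin (subtopology T S) C \<and> closedin (subtopology T S) D \<and> C \<union> D = S
            \<longrightarrow> C = S \<or> D = S) \<longleftrightarrow>
        (\<forall>C D. closedin T C \<and> closedin T D \<and> S \<subseteq> C \<union> D \<longrightarrow> S \<subseteq> C \<or> S \<subseteq> D)" (is "?L \<longleftrightarrow> ?R")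
  proof
    assume L: ?L
    show ?R
    proof (intro allI impI)
      fix C D assume CD: "closedin T C \<and> closedin T D \<and> S \<subseteq> C \<union> D"
      then have "closedin (subtopology T S) (C \<inter> S)" "closedin (subtopology T S) (D \<inter> S)"
        "C \<inter> S \<union> D \<inter> S = S"
        by (auto simp: closedin_subtopology)
      then show "S \<subseteq> C \<or> S \<subseteq> D" using L by blast
    qed
  next
    assume R: ?R
    show ?L
    proof (intro allI impI)
      fix C D assume "closedin (subtopology T S) C \<and> closedin (subtopology T S) D \<and> C \<union> D = S"
      then obtain C' D' where "closedin T C'" "C = C' \<inter> S" "closedin T D'" "D = D' \<inter> S"
        "C \<union> D = S"
        by (auto simp: closedin_subtopology)
      moreover from this have "S \<subseteq> C' \<or> S \<subseteq> D'" using R by blast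
      ultimately show "C = S \<or> D = S" by blast
    qed
  qed
  with True show ?thesis
    by (simp add: irreduciblein_def irreducible_space_def topspace_subtopology_subset Int_absorb1)
qed (simp add: irreduciblein_def)

lemma irreduciblein_topspace: "irreduciblein T (topspace T) \<longleftrightarrow> irreducible_space T"
  by (simp add: irreduciblein_def)

lemma irreduciblein_singleton: "x \<in> topspace T \<Longrightarrow> irreduciblein T {x}"
  by (auto simp: irreduciblein_iff)

lemma irreduciblein_closure_of:
  assumes "irreduciblein T S"
  shows "irreduciblein T (T closure_of S)"
  using assms closure_of_subset[of S T] closure_of_minimal[of S _ T]
    closure_of_subset_topspace[of T S]
  unfolding irreduciblein_iff by (metis order_trans subset_empty)

lemma irreduciblein_continuous_image:
  assumes f: "continuous_map T T' f" and S: "irreduciblein T S"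
  shows "irreduciblein T' (f ` S)"
  unfolding irreduciblein_iff
proof (intro conjI allI impI)
  have sub: "S \<subseteq> topspace T" using S by (simp add: irreduciblein_iff)
  then show "f ` S \<subseteq> topspace T'" using continuous_map_image_subset_topspace[OF f] by blast
  show "f ` S \<noteq> {}" using S by (simp add: irreduciblein_iff)
  fix C D assume CD: "closedin T' C \<and> closedin T' D \<and> f ` S \<subseteq> C \<union> D"
  define pre where "pre A = {x \<in> topspace T. f x \<in> A}" for A
  have "closedin T (pre C)" "closedin T (pre D)" "S \<subseteq> pre C \<union> pre D"
    using CD f sub by (auto simp: pre_def continuous_map_closedin)
  then have "S \<subseteq> pre C \<or> S \<subseteq> pre D" using S by (simp add: irreduciblein_iff)
  then show "f ` S \<subseteq> C \<or> f ` S \<subseteq> D" by (auto simp: pre_def)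
qed

lemma irreduciblein_Union_chain:
  assumes irr: "\<And>S. S \<in> \<C> \<Longrightarrow> irreduciblein T S" and ne: "\<C> \<noteq> {}"
    and chain: "\<And>A B. A \<in> \<C> \<Longrightarrow> B \<in> \<C> \<Longrightarrow> A \<subseteq> B \<or> B \<subseteq> A"
  shows "irreduciblein T (\<Union>\<C>)"
  unfolding irreduciblein_iff
proof (intro conjI allI impI)
  show "\<Union>\<C> \<subseteq> topspace T" "\<Union>\<C> \<noteq> {}"
    using irr ne by (auto simp: irreduciblein_iff)
  fix C D assume CD: "closedin T C \<and> closedin T D \<and> \<Union>\<C> \<subseteq> C \<union> D"
  show "\<Union>\<C> \<subseteq> C \<or> \<Union>\<C> \<subseteq> D"
  proof (rule ccontr)
    assume "\<not> ?thesis"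
    then obtain A B where AB: "A \<in> \<C>" "\<not> A \<subseteq> C" "B \<in> \<C>" "\<not> B \<subseteq> D" by blast
    \<comment> \<open>The larger of the two members lies neither in \<open>C\<close> nor in \<open>D\<close>.\<close>
    then obtain M where "M \<in> \<C>" "A \<subseteq> M" "B \<subseteq> M" using chain[of A B] by blast
    moreover from this have "M \<subseteq> C \<or> M \<subseteq> D"
      using CD irr[of M] unfolding irreduciblein_iff by blast
    ultimately show False using AB by blast
  qed
qed

lemma irreduciblein_finite_closed_cover:
  assumes S: "irreduciblein T S" and "finite \<F>"
    and "\<And>C. C \<in> \<F> \<Longrightarrow> closedin T C" and "S \<subseteq> \<Union>\<F>"
  shows "\<exists>C\<in>\<F>. S \<subseteq> C"
  using assms(2-)
proof (induction \<F>)
  case empty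
  then show ?case using S by (auto simp: irreduciblein_iff)
next
  case (insert C \<F>)
  then have "closedin T C" "closedin T (\<Union>\<F>)" "S \<subseteq> C \<union> \<Union>\<F>"
    by (auto intro!: closedin_Union)
  then have "S \<subseteq> C \<or> S \<subseteq> \<Union>\<F>" using S by (simp add: irreduciblein_iff)
  then show ?case using insert by auto
qed

lemma irreduciblein_subset_component:
  assumes S: "irreduciblein T S"
  shows "\<exists>C\<in>irreducible_components T. S \<subseteq> C"
proof -
  let ?A = "{A. irreduciblein T A \<and> S \<subseteq> A}"
  have "\<exists>M\<in>?A. \<forall>X\<in>?A. M \<subseteq> X \<longrightarrow> X = M"
  proof (rule subset_Zorn_nonempty)
    show "?A \<noteq> {}" using S by blast
    fix \<C> assume ne: "\<C> \<noteq> {}" and ch: "subset.chain ?A \<C>"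
    have "irreduciblein T (\<Union>\<C>)"
      using ch by (intro irreduciblein_Union_chain ne) (auto simp: subset_chain_def)
    moreover have "S \<subseteq> \<Union>\<C>" using ne ch unfolding subset_chain_def by blast
    ultimately show "\<Union>\<C> \<in> ?A" by blast
  qed
  then obtain M where "M \<in> ?A" and max: "\<forall>X\<in>?A. M \<subseteq> X \<longrightarrow> X = M" by (rule bexE)
  then have M: "irreduciblein T M" "S \<subseteq> M" by simp_all
  have "X = M" if "irreduciblein T X" "M \<subseteq> X" for X
    using max that M(2) by auto
  with M(1) have "M \<in> irreducible_components T" by (simp add: irreducible_components_def)
  then show ?thesis using M(2) by blast
qed

lemma Union_irreducible_components: "\<Union>(irreducible_components T) = topspace T"
proof
  show "\<Union>(irreducible_components T) \<subseteq> topspace T"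
    by (auto simp: irreducible_components_def irreduciblein_def)
  show "topspace T \<subseteq> \<Union>(irreducible_components T)"
  proof
    fix x assume "x \<in> topspace T"
    from irreduciblein_subset_component[OF irreduciblein_singleton[OF this]]
    show "x \<in> \<Union>(irreducible_components T)" by blast
  qed
qed

lemma closedin_irreducible_component:
  assumes "C \<in> irreducible_components T"
  shows "closedin T C"
proof -
  have "irreduciblein T C" using assms by (simp add: irreducible_components_def)
  then have "irreduciblein T (T closure_of C)" "C \<subseteq> T closure_of C"
    by (simp_all add: irreduciblein_closure_of closure_of_subset irreduciblein_def[of T C])
  then have "T closure_of C = C"
    using assms by (auto simp: irreducible_components_def)
  then show ?thesis by (metis closedin_closure_of)
qed

section \<open>Chains through a sequence of boundedly many sets\<close>

text \<open>
  The union of a chain that follows a fixed choice of successors is determined by any of its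
  members together with the level of that member, so there are at most \<open>N\<close> such unions. The
  finite set \<open>\<F>\<close> contains a chain for each of them.
\<close>

lemma finitely_many_chains:
  fixes K :: "nat \<Rightarrow> 'a set set"
  assumes fin: "\<And>n. finite (K n)" and card: "\<And>n. card (K n) \<le> N"
    and next_ex: "\<And>n C. C \<in> K n \<Longrightarrow> \<exists>D\<in>K (Suc n). C \<subseteq> D"
  obtains \<F> where "finite \<F>"
    and "\<And>Z. Z \<in> \<F> \<Longrightarrow> (\<forall>n. Z n \<in> (\<Union>m. K m)) \<and> (\<forall>n. Z n \<subseteq> Z (Suc n))"
    and "(\<Union>Z\<in>\<F>. \<Union>n. Z n) = (\<Union>n. \<Union>(K n))"
proof -
  define \<phi> where "\<phi> n C = (SOME D. D \<in> K (Suc n) \<and> C \<subseteq> D)" for n C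
  have \<phi>: "\<phi> n C \<in> K (Suc n) \<and> C \<subseteq> \<phi> n C" if "C \<in> K n" for n C
    using someI_ex[of "\<lambda>D. D \<in> K (Suc n) \<and> C \<subseteq> D"] next_ex[OF that] by (auto simp: \<phi>_def)
  define t where "t = (\<lambda>(m, C). rec_nat C (\<lambda>j. \<phi> (m + j)))"
  have t_0: "t (m, C) 0 = C" and t_Suc: "t (m, C) (Suc j) = \<phi> (m + j) (t (m, C) j)" for m C j
    by (auto simp: t_def)
  have t_in: "t (m, C) j \<in> K (m + j)" if "C \<in> K m" for m C j
    using that by (induction j) (auto simp: t_0 t_Suc \<phi>)
  have t_mono: "t (m, C) j \<subseteq> t (m, C) (Suc j)" if "C \<in> K m" for m C j
    using \<phi> t_in[OF that] by (simp add: t_Suc)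
  have t_shift: "t (m + i, t (m, C) i) j = t (m, C) (i + j)" for m C i j
    by (induction j) (auto simp: t_0 t_Suc add.assoc)
  define U where "U p = (\<Union>j. t p j)" for p
  have U_shift: "U (m + i, t (m, C) i) = U (m, C)" if "C \<in> K m" for m C i
  proof
    show "U (m + i, t (m, C) i) \<subseteq> U (m, C)" by (auto simp: U_def t_shift)
    have "t (m, C) j \<subseteq> t (m, C) (i + j)" for j
      by (rule lift_Suc_mono_le[of "t (m, C)"]) (auto simp: t_mono that)
    then show "U (m, C) \<subseteq> U (m + i, t (m, C) i)" by (auto simp: U_def t_shift)
  qed
  define P where "P = (SIGMA m:UNIV. K m)"
  have bounded: "finite (U ` P)"
  proof (rule ccontr)
    assume "infinite (U ` P)"
    then obtain G where G: "G \<subseteq> U ` P" "finite G" "card G = Suc N"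
      using infinite_arbitrarily_large by metis
    then obtain Q where Q: "Q \<subseteq> P" "finite Q" "G = U ` Q"
      by (meson finite_subset_image)
    \<comment> \<open>At a level \<open>M\<close> that all chains starting in \<open>Q\<close> have reached, \<open>K M\<close> determines their unions.\<close>
    obtain M where M: "\<And>m C. (m, C) \<in> Q \<Longrightarrow> m \<le> M"
      using Q(2) finite_nat_set_iff_bounded_le[of "fst ` Q"] by force
    have "G \<subseteq> (\<lambda>C. U (M, C)) ` K M"
    proof
      fix A assume "A \<in> G"
      then obtain m C where mC: "(m, C) \<in> Q" "A = U (m, C)" using Q by auto
      then have "C \<in> K m" "m + (M - m) = M" using Q(1) M by (auto simp: P_def)
      then show "A \<in> (\<lambda>C. U (M, C)) ` K M"
        using t_in[of C m "M - m"] U_shift[of C m "M - m"] mC by (auto intro!: image_eqI)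
    qed
    then have "card G \<le> card (K M)"
      using fin by (meson card_image_le card_mono finite_imageI order_trans)
    then show False using card[of M] G(3) by simp
  qed
  then obtain Q where Q: "Q \<subseteq> P" "finite Q" "U ` P = U ` Q"
    using finite_subset_image[of "U ` P" U P] by blast
  show thesis
  proof
    show "finite (t ` Q)" using Q by simp
    show "(\<forall>n. Z n \<in> (\<Union>m. K m)) \<and> (\<forall>n. Z n \<subseteq> Z (Suc n))" if "Z \<in> t ` Q" for Z
      using that Q(1) t_in t_mono by (fastforce simp: P_def)
    have "(\<Union>Z\<in>t ` Q. \<Union>n. Z n) = \<Union>(U ` P)" unfolding Q(3) by (simp add: U_def)
    also have "\<dots> = (\<Union>n. \<Union>(K n))"
    proof
      show "\<Union>(U ` P) \<subseteq> (\<Union>n. \<Union>(K n))" using t_in by (fastforce simp: U_def P_def)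
      show "(\<Union>n. \<Union>(K n)) \<subseteq> \<Union>(U ` P)"
      proof clarify
        fix x n C assume "x \<in> C" "C \<in> K n"
        then have "x \<in> t (n, C) 0" "(n, C) \<in> P" by (auto simp: t_0 P_def)
        then show "x \<in> \<Union>(U ` P)" by (auto simp: U_def)
      qed
    qed
    finally show "(\<Union>Z\<in>t ` Q. \<Union>n. Z n) = (\<Union>n. \<Union>(K n))" .
  qed
qed

section \<open>Irreducibility of ind-varieties\<close>

lemma continuous_map_filtration_step:
  assumes V: "affine_ind_variety V"
  shows "continuous_map (zariski_topology (V n)) (zariski_topology (V (Suc n))) (\<lambda>x. x)"
  unfolding continuous_map_closedin
proof (intro conjI allI impI)
  have aff: "affine_variety (V m)" for m using V by (simp add: affine_ind_variety_def)
  note ts = topspace_zariski[OF aff]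
  show "(\<lambda>x. x) \<in> topspace (zariski_topology (V n)) \<rightarrow> topspace (zariski_topology (V (Suc n)))"
    using points_Suc_subset[OF V] by (auto simp: ts)
  fix C assume "closedin (zariski_topology (V (Suc n))) C"
  then obtain E where E: "E \<subseteq> regular (V (Suc n))" "C = zero_set (V (Suc n)) E"
    by (auto simp: closedin_zariski[OF aff])
  let ?r = "\<lambda>g. restrict g (points (V n))"
  have "morphism (V n) (subvariety (V (Suc n)) (points (V n))) (\<lambda>x. x)"
    using V by (simp add: affine_ind_variety_def closed_embedding_def isomorphism_def)
  then have "?r g \<in> regular (V n)" if "g \<in> regular (V (Suc n))" for g
    using that by (auto simp: morphism_def subvariety_def comp_def restrict_def cong: if_cong)
  then have "?r ` E \<subseteq> regular (V n)" using E(1) by blast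
  moreover have "{x \<in> topspace (zariski_topology (V n)). x \<in> C} = zero_set (V n) (?r ` E)"
    using points_Suc_subset[OF V] by (auto simp: ts E(2) zero_set_def)
  ultimately show "closedin (zariski_topology (V n)) {x \<in> topspace (zariski_topology (V n)). x \<in> C}"
    by (auto simp: closedin_zariski[OF aff])
qed

lemma continuous_map_ind_topology:
  assumes V: "affine_ind_variety V"
  shows "continuous_map (zariski_topology (V n)) (ind_topology V) (\<lambda>x. x)"
proof -
  have ts: "topspace (zariski_topology (V n)) = points (V n)"
    using V by (intro topspace_zariski) (simp add: affine_ind_variety_def)
  have "{x \<in> points (V n). x \<in> C} = C \<inter> points (V n)" for C by blast
  then show ?thesis
    by (auto simp: continuous_map_closedin ts topspace_ind_topology[OF V]
        closedin_ind_topology[OF V] ind_points_def)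
qed

lemma continuous_map_ind_zariski_topology:
  assumes V: "affine_ind_variety V"
  shows "continuous_map (zariski_topology (V n)) (ind_zariski_topology V) (\<lambda>x. x)"
  unfolding continuous_map_closedin
proof (intro conjI allI impI)
  have aff: "affine_variety (V n)" using V by (simp add: affine_ind_variety_def)
  note ts = topspace_zariski[OF aff]
  show "(\<lambda>x. x) \<in> topspace (zariski_topology (V n)) \<rightarrow> topspace (ind_zariski_topology V)"
    by (auto simp: ts topspace_ind_zariski[OF V] ind_points_def)
  fix C assume "closedin (ind_zariski_topology V) C"
  then obtain E where E: "E \<subseteq> ind_regular V" "C = ind_zero_set V E"
    by (auto simp: closedin_ind_zariski[OF V])
  have "(\<lambda>f. f n) ` E \<subseteq> regular (V n)" using E(1) by (auto simp: ind_regular_def)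
  moreover have "ind_eval V f x = f n x" if "f \<in> E" "x \<in> points (V n)" for f x
    using that E(1) ind_eval_eq[OF V] by blast
  then have "{x \<in> topspace (zariski_topology (V n)). x \<in> C} = zero_set (V n) ((\<lambda>f. f n) ` E)"
    by (auto simp: ts E(2) zero_set_def ind_zero_set_def ind_points_def)
  ultimately show "closedin (zariski_topology (V n)) {x \<in> topspace (zariski_topology (V n)). x \<in> C}"
    by (auto simp: closedin_zariski[OF aff])
qed

text \<open>
  An irreducible space covered by the unions of finitely many chains is the closure of one of
  them. The components of the \<open>X\<^sub>n\<close> supply such chains, because an irreducible subset of \<open>X\<^sub>n\<close> stays
  irreducible in \<open>X\<^sub>n\<^sub>+\<^sub>1\<close> and hence lies in one of its components.
\<close>

lemma irreducible_iff_dense_chain: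
  fixes V :: "nat \<Rightarrow> ('a, 'k::field) variety"
  assumes V: "affine_ind_variety V"
    and fin: "\<And>n. finite (irreducible_components (zariski_topology (V n)))"
    and card: "\<And>n. card (irreducible_components (zariski_topology (V n))) \<le> N"
    and ts: "topspace T = ind_points V"
    and cont: "\<And>n. continuous_map (zariski_topology (V n)) T (\<lambda>x. x)"
  shows "irreducible_space T \<longleftrightarrow>
    (\<exists>Z. (\<forall>n. irreducible_subvariety V (Z n)) \<and> (\<forall>n. Z n \<subseteq> Z (Suc n)) \<and>
       T closure_of (\<Union>n. Z n) = topspace T)"
proof
  assume T: "irreducible_space T"
  let ?K = "\<lambda>n. irreducible_components (zariski_topology (V n))"
  have K: "irreduciblein (zariski_topology (V n)) C" "closedin (zariski_topology (V n)) C"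
    if "C \<in> ?K n" for n C
    using that closedin_irreducible_component by (auto simp: irreducible_components_def)
  have "\<exists>D\<in>?K (Suc n). C \<subseteq> D" if "C \<in> ?K n" for n C
    using irreduciblein_continuous_image[OF continuous_map_filtration_step[OF V] K(1)[OF that]]
    by (simp add: irreduciblein_subset_component)
  then obtain \<F> where \<F>: "finite \<F>"
    "\<And>Z. Z \<in> \<F> \<Longrightarrow> (\<forall>n. Z n \<in> (\<Union>m. ?K m)) \<and> (\<forall>n. Z n \<subseteq> Z (Suc n))"
    "(\<Union>Z\<in>\<F>. \<Union>n. Z n) = (\<Union>n. \<Union>(?K n))"
    using finitely_many_chains[where K = ?K, OF fin card] by metis
  have "(\<Union>n. \<Union>(?K n)) = topspace T"
    using V by (simp add: Union_irreducible_components topspace_zariski affine_ind_variety_def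
        ts ind_points_def)
  with \<F>(3) have cover: "(\<Union>Z\<in>\<F>. \<Union>n. Z n) = topspace T" by simp
  have "(\<Union>n. Z n) \<subseteq> T closure_of (\<Union>n. Z n)" if "Z \<in> \<F>" for Z
    using that cover by (intro closure_of_subset) blast
  then have "(\<Union>Z\<in>\<F>. \<Union>n. Z n) \<subseteq> (\<Union>Z\<in>\<F>. T closure_of (\<Union>n. Z n))"
    by (rule UN_mono[OF order_refl])
  then have "topspace T \<subseteq> (\<Union>Z\<in>\<F>. T closure_of (\<Union>n. Z n))" by (simp only: cover)
  then have "\<exists>C\<in>(\<lambda>Z. T closure_of (\<Union>n. Z n)) ` \<F>. topspace T \<subseteq> C"
    using T \<F>(1)
    by (intro irreduciblein_finite_closed_cover[of T]) (auto simp: irreduciblein_topspace)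
  then obtain Z where Z: "Z \<in> \<F>" "topspace T \<subseteq> T closure_of (\<Union>n. Z n)" by blast
  have "irreducible_subvariety V (Z n)" for n
    using \<F>(2)[OF Z(1)] K unfolding irreducible_subvariety_def by blast
  moreover have "T closure_of (\<Union>n. Z n) = topspace T"
    using closure_of_subset_topspace Z(2) by (rule equalityI)
  ultimately show "\<exists>Z. (\<forall>n. irreducible_subvariety V (Z n)) \<and> (\<forall>n. Z n \<subseteq> Z (Suc n)) \<and>
       T closure_of (\<Union>n. Z n) = topspace T"
    using \<F>(2)[OF Z(1)] by (intro exI[of _ Z]) simp
next
  assume "\<exists>Z. (\<forall>n. irreducible_subvariety V (Z n)) \<and> (\<forall>n. Z n \<subseteq> Z (Suc n)) \<and>
       T closure_of (\<Union>n. Z n) = topspace T"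
  then obtain Z where irr: "\<And>n. irreducible_subvariety V (Z n)"
    and mono: "\<And>n. Z n \<subseteq> Z (Suc n)" and dense: "T closure_of (\<Union>n. Z n) = topspace T"
    by blast
  have "irreduciblein T (Z n)" for n
    using irr[of n] irreduciblein_continuous_image[OF cont]
    by (fastforce simp: irreducible_subvariety_def)
  moreover have "Z i \<subseteq> Z j \<or> Z j \<subseteq> Z i" for i j
    using lift_Suc_mono_le[of Z, OF mono] nat_le_linear by blast
  ultimately have "irreduciblein T (\<Union>n. Z n)"
    by (intro irreduciblein_Union_chain) auto
  from irreduciblein_closure_of[OF this] show "irreducible_space T"
    by (simp add: dense irreduciblein_topspace)
qed

theorem proposition4:
  fixes V :: "nat \<Rightarrow> ('a, 'k::{alg_closed_field, field_char_0}) variety"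
  assumes "uncountable (UNIV :: 'k set)"
    and "affine_ind_variety V"
    and "\<exists>N. \<forall>n. finite (irreducible_components (zariski_topology (V n))) \<and>
           card (irreducible_components (zariski_topology (V n))) \<le> N"
  shows "(irreducible_space (ind_topology V) \<longleftrightarrow>
           (\<exists>Z. (\<forall>n. irreducible_subvariety V (Z n)) \<and> (\<forall>n. Z n \<subseteq> Z (Suc n)) \<and>
              ind_topology V closure_of (\<Union>n. Z n) = topspace (ind_topology V))) \<and>
         (irreducible_space (ind_zariski_topology V) \<longleftrightarrow>
           (\<exists>Z. (\<forall>n. irreducible_subvariety V (Z n)) \<and> (\<forall>n. Z n \<subseteq> Z (Suc n)) \<and>
              ind_zariski_topology V closure_of (\<Union>n. Z n) = topspace (ind_zariski_topology V)))"
proof -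
  note V = assms(2)
  from assms(3) obtain N
    where fin: "\<And>n. finite (irreducible_components (zariski_topology (V n)))"
      and card: "\<And>n. card (irreducible_components (zariski_topology (V n))) \<le> N"
    by blast
  note equivalence = irreducible_iff_dense_chain[OF V fin card]
  show ?thesis
    using equivalence[OF topspace_ind_topology[OF V] continuous_map_ind_topology[OF V]]
      equivalence[OF topspace_ind_zariski[OF V] continuous_map_ind_zariski_topology[OF V]]
    by (rule conjI)
qed

end
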